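(* Let $f$ be a real analytic function on an open interval $(a,b)\subset\mathbb{R}$, let $n\in\mathbb{N}$, $n\ge 1$, let $x,x_0\in(a,b)$, and let $k\in\mathbb{R}$, $k\neq 0$, be such that $x+ik\in(a,b)$ for all $i=0,1,\ldots,n$. Then there exist points $\xi_0,\ldots,\xi_n\in(a,b)$, with $\xi_i$ lying strictly between $x_0$ and $x+ik$ whenever $x+ik\neq x_0$, such that $$ f^{(n)}(x_{0})(-k)^{n} = \sum^{n}_{i=0}\binom{n}{i} (-1)^{i} f(x+ik) - \sum^{n}_{i=0}\binom{n}{i} (-1)^{i} \frac{f^{(n+1)}(\xi_{i})}{(n+1)!}(x - x_{0} + ik)^{n+1}. $$
   Context: Here $f^{(m)}$ denotes the $m$-th derivative of $f$. The points $\xi_i$ are the intermediate points of the Lagrange form of the remainder in Taylor's theorem of order $n$ for $f$ at $x_0$, evaluated at $x+ik$. *)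

theory Defs
  imports "HOL-Analysis.Analysis"
begin

(* The library's analytic_on is complex analyticity. On a non-open set, the definition below
   would constrain f on a neighbourhood of the set; it is used for open intervals only. *)
definition real_analytic_on :: "(real \<Rightarrow> real) \<Rightarrow> real set \<Rightarrow> bool" where
  "real_analytic_on f S \<longleftrightarrow> (\<forall>c\<in>S. \<exists>F. (\<lambda>h. f (c + h)) has_fps_expansion F)"

definition lagrange_remainder_at :: "(real \<Rightarrow> real) \<Rightarrow> nat \<Rightarrow> real \<Rightarrow> real \<Rightarrow> real \<Rightarrow> bool" where
  "lagrange_remainder_at f n x0 y \<xi> \<longleftrightarrow>
     f y = (\<Sum>m\<le>n. (deriv ^^ m) f x0 / fact m * (y - x0) ^ m)
           + (deriv ^^ Suc n) f \<xi> / fact (Suc n) * (y - x0) ^ Suc n"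

end

theory Submission
  imports Defs
begin

text \<open>The alternating binomial sum is the \<open>n\<close>-th finite difference with step \<open>k\<close> (up to sign).
  Applied to Taylor's formula at the points \<open>x + i k\<close>, it kills the powers
  \<open>(x + i k - x0)^m\<close> with \<open>m < n\<close> and sends the \<open>n\<close>-th power to \<open>n! (-k)^n\<close>, so that only the
  \<open>n\<close>-th derivative and the remainders survive.\<close>

text \<open>Pascal's rule splits the left side into an unshifted and a shifted sum with coefficients
  \<open>n choose i\<close>. In terms of differences, a difference of order \<open>Suc n\<close> is
  the difference of order \<open>n\<close> applied to a first difference, which is what drives the
  induction below.\<close>

lemma alternating_binomial_sum_Suc:
  fixes g :: "nat \<Rightarrow> 'a :: comm_ring_1"
  shows "(\<Sum>i\<le>Suc n. of_nat (Suc n choose i) * (- 1) ^ i * g i) =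
         (\<Sum>i\<le>n. of_nat (n choose i) * (- 1) ^ i * (g i - g (Suc i)))"
proof -
  have "(\<Sum>i\<le>Suc n. of_nat (Suc n choose i) * (- 1) ^ i * g i) =
        g 0 + (\<Sum>i\<le>n. of_nat (n choose Suc i) * (- 1) ^ Suc i * g (Suc i))
            - (\<Sum>i\<le>n. of_nat (n choose i) * (- 1) ^ i * g (Suc i))"
    by (simp add: sum.atMost_Suc_shift algebra_simps sum.distrib sum_negf sum_subtractf
          del: sum.atMost_Suc)
  also have "g 0 + (\<Sum>i\<le>n. of_nat (n choose Suc i) * (- 1) ^ Suc i * g (Suc i)) =
             (\<Sum>i\<le>Suc n. of_nat (n choose i) * (- 1) ^ i * g i)"
    by (simp add: sum.atMost_Suc_shift del: sum.atMost_Suc)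
  also have "\<dots> = (\<Sum>i\<le>n. of_nat (n choose i) * (- 1) ^ i * g i)"
    by (simp add: binomial_eq_0)
  finally show ?thesis
    by (simp add: sum_subtractf algebra_simps)
qed

text \<open>The top term \<open>y ^ m\<close> of the binomial expansion cancels, so a first
  difference lowers the degree of a power.\<close>

lemma power_diff_shift_binomial:
  fixes y k :: "'a :: comm_ring_1"
  shows "y ^ m - (y + k) ^ m = - (\<Sum>j<m. of_nat (m choose j) * k ^ (m - j) * y ^ j)"
proof -
  have "(y + k) ^ m = (\<Sum>j\<le>m. of_nat (m choose j) * y ^ j * k ^ (m - j))"
    by (rule binomial_ring)
  also have "\<dots> = (\<Sum>j<m. of_nat (m choose j) * k ^ (m - j) * y ^ j) + y ^ m"
    by (simp add: lessThan_Suc_atMost [symmetric] mult_ac)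
  finally show ?thesis by simp
qed

text \<open>By induction on \<open>n\<close> with \<open>m\<close> arbitrary: one first difference
  turns the \<open>m\<close>-th power into a combination of powers \<open>j < m\<close>, and
  \<open>m \<le> Suc n\<close> then gives \<open>j \<le> n\<close>, so the induction hypothesis
  covers each of them.\<close>

lemma alternating_binomial_sum_power:
  fixes c k :: "'a :: {comm_ring_1, ring_char_0}"
  assumes "m \<le> n"
  shows "(\<Sum>i\<le>n. of_nat (n choose i) * (- 1) ^ i * (c + of_nat i * k) ^ m) =
         (if m = n then fact n * (- k) ^ n else 0)"
  using assms
proof (induction n arbitrary: m)
  case 0
  then show ?case by simp
next
  case (Suc n)
  let ?S = "\<lambda>j. \<Sum>i\<le>n. of_nat (n choose i) * (- 1) ^ i * (c + of_nat i * k) ^ j"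
  have step: "(c + of_nat i * k) ^ m - (c + of_nat (Suc i) * k) ^ m =
      - (\<Sum>j<m. of_nat (m choose j) * k ^ (m - j) * (c + of_nat i * k) ^ j)" for i
    using power_diff_shift_binomial [of "c + of_nat i * k" m k] by (simp add: algebra_simps)
  have "(\<Sum>i\<le>Suc n. of_nat (Suc n choose i) * (- 1) ^ i * (c + of_nat i * k) ^ m) =
        (\<Sum>i\<le>n. \<Sum>j<m. - (of_nat (m choose j) * k ^ (m - j) *
           (of_nat (n choose i) * (- 1) ^ i * (c + of_nat i * k) ^ j)))"
    by (subst alternating_binomial_sum_Suc, subst step)
       (simp add: sum_distrib_left sum_negf mult_ac)
  also have "\<dots> = - (\<Sum>j<m. of_nat (m choose j) * k ^ (m - j) * ?S j)"
    by (subst sum.swap) (simp add: sum_distrib_left sum_negf)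
  also have "(\<Sum>j<m. of_nat (m choose j) * k ^ (m - j) * ?S j) =
      (\<Sum>j<m. of_nat (m choose j) * k ^ (m - j) * (if j = n then fact n * (- k) ^ n else 0))"
    using Suc.prems by (intro sum.cong refl, subst Suc.IH) auto
  \<comment> \<open>The index \<open>j = n\<close> lies in the range \<open>j < m\<close> only for
    \<open>m = Suc n\<close>. Its coefficient is then \<open>(Suc n choose n) * k\<close>, that is
    \<open>(n + 1) * k\<close>, which together with the outer minus sign supplies the missing
    factors of \<open>fact (Suc n) * (- k) ^ Suc n\<close>.\<close>
  also have "- \<dots> = (if m = Suc n then fact (Suc n) * (- k) ^ Suc n else 0)"
  proof (cases "m = Suc n")
    case True
    then show ?thesis by (simp add: algebra_simps)
  next
    case False
    with Suc.prems show ?thesis by (auto intro!: sum.neutral)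
  qed
  finally show ?case .
qed

text \<open>Near 0 the function agrees with its power series, which is differentiable inside its
  disc of convergence.\<close>

lemma has_fps_expansion_imp_DERIV_0:
  fixes f :: "'a :: {banach, real_normed_field} \<Rightarrow> 'a"
  assumes "f has_fps_expansion F"
  shows "(f has_field_derivative deriv f 0) (at 0)"
proof -
  have "(eval_fps F has_field_derivative eval_fps (fps_deriv F) 0) (at 0)"
    using assms by (intro has_field_derivative_eval_fps) (auto simp: has_fps_expansion_def zero_ereal_def)
  moreover have "eventually (\<lambda>z. eval_fps F z = f z) (nhds 0)"
    using assms by (simp add: has_fps_expansion_def)
  ultimately have "(f has_field_derivative eval_fps (fps_deriv F) 0) (at 0)"
    using DERIV_cong_ev [of 0 0 "eval_fps F" f] by simp
  then show ?thesis
    using DERIV_imp_deriv by fastforce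
qed

text \<open>Differentiability of \<open>f\<close> is not at issue: \<open>deriv\<close> is a choice
  from the set of possible derivatives, and translation leaves that set unchanged.\<close>

lemma deriv_shift_left: "deriv (\<lambda>h. f (c + h)) = (\<lambda>h. deriv f (c + h))"
  by (simp add: fun_eq_iff deriv_def DERIV_shift add.commute [of c])

lemma real_analytic_on_deriv:
  assumes "real_analytic_on f S"
  shows "real_analytic_on (deriv f) S"
  unfolding real_analytic_on_def
proof
  fix c assume "c \<in> S"
  then obtain F where "(\<lambda>h. f (c + h)) has_fps_expansion F"
    using assms by (auto simp: real_analytic_on_def)
  from has_fps_expansion_deriv [OF this]
  show "\<exists>F. (\<lambda>h. deriv f (c + h)) has_fps_expansion F"
    by (auto simp: deriv_shift_left)
qed

lemma real_analytic_on_higher_deriv: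
  "real_analytic_on f S \<Longrightarrow> real_analytic_on ((deriv ^^ m) f) S"
  by (induction m) (auto intro: real_analytic_on_deriv)

lemma real_analytic_on_imp_DERIV:
  assumes "real_analytic_on f S" "c \<in> S"
  shows "(f has_field_derivative deriv f c) (at c)"
proof -
  obtain F where "(\<lambda>h. f (c + h)) has_fps_expansion F"
    using assms by (auto simp: real_analytic_on_def)
  from has_fps_expansion_imp_DERIV_0 [OF this]
  have "((\<lambda>h. f (c + h)) has_field_derivative deriv f c) (at 0)"
    by (simp add: deriv_shift_left)
  then show ?thesis
    using DERIV_shift [of f "deriv f c" 0 c] by (simp add: add.commute [of c])
qed

text \<open>Analyticity makes all iterated derivatives differentiable on \<open>S\<close>, and
  \<open>is_interval S\<close> keeps the whole segment from \<open>x0\<close> to \<open>y\<close>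
  inside \<open>S\<close>, so Taylor's theorem applies when \<open>y \<noteq> x0\<close>. For
  \<open>y = x0\<close> the remainder vanishes and \<open>x0\<close> itself serves as the
  witness.\<close>

lemma real_analytic_lagrange_remainder:
  assumes "real_analytic_on f S" "is_interval S" "x0 \<in> S" "y \<in> S"
  shows "\<exists>\<xi>\<in>S. (y \<noteq> x0 \<longrightarrow> \<xi> \<in> open_segment x0 y) \<and> lagrange_remainder_at f n x0 y \<xi>"
proof (cases "y = x0")
  case True
  \<comment> \<open>Since \<open>0 ^ 0 = 1\<close>, the term \<open>m = 0\<close> survives.\<close>
  have "(\<Sum>m\<le>n. (deriv ^^ m) f x0 / fact m * 0 ^ m) = f x0"
    by (simp add: sum.atMost_shift)
  then have "lagrange_remainder_at f n x0 x0 x0"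
    by (simp add: lagrange_remainder_at_def)
  with True assms show ?thesis by auto
next
  case False
  have seg: "t \<in> S" if "min x0 y \<le> t" "t \<le> max x0 y" for t
    using assms(2-4) that mem_is_interval_1_I [of S x0 y t] mem_is_interval_1_I [of S y x0 t]
    by (auto simp: min_def max_def split: if_splits)
  have "\<forall>m t. m < Suc n \<and> min x0 y \<le> t \<and> t \<le> max x0 y \<longrightarrow>
      DERIV ((deriv ^^ m) f) t :> (deriv ^^ Suc m) f t"
    using real_analytic_on_imp_DERIV [OF real_analytic_on_higher_deriv [OF assms(1)]] seg by simp
  from Taylor [where diff = "\<lambda>m. (deriv ^^ m) f", OF _ _ this, of f x0 y] False
  obtain t where t: "if y < x0 then y < t \<and> t < x0 else x0 < t \<and> t < y"
    "f y = (\<Sum>m<Suc n. (deriv ^^ m) f x0 / fact m * (y - x0) ^ m)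
           + (deriv ^^ Suc n) f t / fact (Suc n) * (y - x0) ^ Suc n"
    by auto
  have "t \<in> S"
    using t(1) by (intro seg) (auto split: if_splits)
  moreover have "t \<in> open_segment x0 y"
    using t(1) by (auto simp: open_segment_eq_real_ivl split: if_splits)
  ultimately show ?thesis
    using t(2) unfolding lagrange_remainder_at_def lessThan_Suc_atMost by blast
qed

theorem mainTheorem1:
  fixes f :: "real \<Rightarrow> real" and a b :: ereal and n :: nat and x x0 k :: real
  assumes "real_analytic_on f (einterval a b)"
    and "n \<ge> 1"
    and "x \<in> einterval a b" and "x0 \<in> einterval a b"
    and "k \<noteq> 0"
    and "\<And>i. i \<le> n \<Longrightarrow> x + real i * k \<in> einterval a b"
  shows "\<exists>\<xi> :: nat \<Rightarrow> real.
    (\<forall>i\<le>n. \<xi> i \<in> einterval a b \<and>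
           (x + real i * k \<noteq> x0 \<longrightarrow> \<xi> i \<in> open_segment x0 (x + real i * k)) \<and>
           lagrange_remainder_at f n x0 (x + real i * k) (\<xi> i)) \<and>
    (deriv ^^ n) f x0 * (- k) ^ n =
      (\<Sum>i=0..n. real (n choose i) * (- 1) ^ i * f (x + real i * k))
      - (\<Sum>i=0..n. real (n choose i) * (- 1) ^ i *
           ((deriv ^^ (n + 1)) f (\<xi> i) / fact (n + 1)) * (x - x0 + real i * k) ^ (n + 1))"
proof -
  have ivl: "is_interval (einterval a b)"
    by (auto simp: is_interval_1 einterval_iff intro: less_le_trans le_less_trans simp flip: ereal_less_eq(3))
  have "\<forall>i\<in>{..n}. \<exists>\<xi>. \<xi> \<in> einterval a b \<and>
      (x + real i * k \<noteq> x0 \<longrightarrow> \<xi> \<in> open_segment x0 (x + real i * k)) \<and>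
      lagrange_remainder_at f n x0 (x + real i * k) \<xi>"
    using real_analytic_lagrange_remainder [OF assms(1) ivl assms(4) assms(6)] by blast
  then obtain \<xi> where \<xi>: "\<forall>i\<in>{..n}. \<xi> i \<in> einterval a b \<and>
      (x + real i * k \<noteq> x0 \<longrightarrow> \<xi> i \<in> open_segment x0 (x + real i * k)) \<and>
      lagrange_remainder_at f n x0 (x + real i * k) (\<xi> i)"
    using bchoice by metis
  define w where "w i = real (n choose i) * (- 1) ^ i" for i
  define d where "d m = (deriv ^^ m) f x0 / fact m" for m
  define R where "R i = (deriv ^^ (n + 1)) f (\<xi> i) / fact (n + 1) * (x - x0 + real i * k) ^ (n + 1)" for i
  \<comment> \<open>With the remainder moved to the left, what is left is a polynomial of degree at
    most \<open>n\<close> in \<open>x - x0 + real i * k\<close>, with coefficients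
    \<open>d m\<close> independent of \<open>i\<close>.\<close>
  have taylor: "f (x + real i * k) - R i = (\<Sum>m\<le>n. d m * (x - x0 + real i * k) ^ m)" if "i \<le> n" for i
  proof -
    have "x + real i * k - x0 = x - x0 + real i * k" by simp
    moreover have "lagrange_remainder_at f n x0 (x + real i * k) (\<xi> i)"
      using \<xi> that by blast
    ultimately show ?thesis
      by (simp only: lagrange_remainder_at_def R_def d_def Suc_eq_plus1 add_diff_cancel_right')
  qed
  have "(\<Sum>i\<le>n. w i * f (x + real i * k)) - (\<Sum>i\<le>n. w i * R i) =
        (\<Sum>i\<le>n. w i * (f (x + real i * k) - R i))"
    by (simp add: sum_subtractf right_diff_distrib)
  also have "\<dots> = (\<Sum>i\<le>n. \<Sum>m\<le>n. d m * (w i * (x - x0 + real i * k) ^ m))"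
    by (intro sum.cong refl) (simp add: taylor sum_distrib_left mult.left_commute)
  also have "\<dots> = (\<Sum>m\<le>n. d m * (\<Sum>i\<le>n. w i * (x - x0 + real i * k) ^ m))"
    by (subst sum.swap) (simp add: sum_distrib_left)
  \<comment> \<open>This is the power sum formula with \<open>c = x - x0\<close>. In the surviving
    term, \<open>fact n\<close> cancels the denominator of \<open>d n\<close>.\<close>
  also have "\<dots> = (\<Sum>m\<le>n. d m * (if m = n then fact n * (- k) ^ n else 0))"
    unfolding w_def by (intro sum.cong refl, subst alternating_binomial_sum_power) auto
  also have "\<dots> = (deriv ^^ n) f x0 * (- k) ^ n"
    by (simp add: if_distrib [of "(*) _"] d_def cong: if_cong)
  finally have "(deriv ^^ n) f x0 * (- k) ^ n =
      (\<Sum>i=0..n. w i * f (x + real i * k)) - (\<Sum>i=0..n. w i * R i)"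
    by (simp add: atMost_atLeast0)
  then show ?thesis
    using \<xi> unfolding w_def R_def by (intro exI [of _ \<xi>]) (simp add: mult.assoc)
qed

end
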